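(* Let $P=(p_1,\dots,p_n)$ be a closed $n$-gon in $\mathbb{P}^1$ with discrete curvature $\mu=(\mu_1,\dots,\mu_n)$, and let $\eta\in\mathbb{G}_m$. The infinitesimal monodromy for the staircase cross-ratio dynamics, under the scaling symmetry $\rho^{(\eta)}$ given by $\mu_i^{(\eta)}(t)=\frac{t\mu_i}{1+(t-1)\eta\mu_i}$, $c_i^{(\eta)}(t)=c_i\frac{t\mu_i}{\mu_i^{(\eta)}(t)}$, is $$M'(1)=\sum_{i=1}^n \eta\mu_i\,\frac{1}{p_i-p_{i+1}}\begin{pmatrix} p_i & -p_ip_{i+1}\\ 1 & -p_{i+1}\end{pmatrix}$$ (as an element of $\mathfrak{pgl}_2$), and its eigenvectors $(X,Y)^T$ are roots of the polynomial $$\chi_P(X,Y)=\sum_{i=1}^n \mu_i\,\frac{(X-p_iY)(X-p_{i+1}Y)}{p_i-p_{i+1}}.$$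
   Context: Let $F$ be a field, $\mathbb{P}^1=\mathbb{P}^1(F)$, $\mathrm{PGL}_2=\mathrm{GL}_2(F)/F^*$, $\mathbb{G}_m=F^*$ (as algebraic group), $n\geq3$. For four points of $\mathbb{P}^1$, $[a,b,c,d]=\frac{a-c}{a-d}\cdot\frac{b-d}{b-c}$. A (twisted) $n$-gon in $\mathbb{P}^1$ is $P=((p_i)_{i\in\mathbb{Z}},M)$ with monodromy $M\in\mathrm{PGL}_2$, $p_{i+n}=Mp_i$, with $p_i,p_{i+1},p_{i+2}$ pairwise distinct for all $i$; it is closed if $M=\mathrm{Id}$. Points are identified with affine coordinates in $F$. $\mathrm{PGL}_2$ acts by $A\cdot P=((Ap_i),AMA^{-1})$, with quotient the moduli space. The cross-ratio coordinates $c_i=[p_i,p_{i+1},p_{i-1},p_{i+2}]$ ($n$-periodic) determine the class $[P]$. Polygons are enriched with an $n$-periodic discrete curvature $\mu=(\mu_i)$, $\mu_i\in\mathbb{G}_m$. The staircase cross-ratio dynamics is the action of the group generated by the flips $\phi_j:(P,\mu)\mapsto(\tilde P,\tilde\mu)$, $j\in\mathbb{Z}/n\mathbb{Z}$, where (with indices taken along $n\mathbb{Z}+j$) $p_j$ is replaced by the point $\tilde p_j$ with $[p_j,\tilde p_j,p_{j+1},p_{j-1}]=\mu_j/\mu_{j-1}$, $\mu_{j-1}$ and $\mu_j$ are interchanged, and everything else (including the monodromy) is unchanged. The action $\rho^{(\eta)}$ of $\mathbb{G}_m$ on $(c,\mu)$ is a scaling symmetry, i.e. a non-trivial (partially defined)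 $\mathbb{G}_m$-action commuting with the flips; write $[P]_t$ for the class with coordinates $c_i^{(\eta)}(t)$. A lift of the deformation is an algebraic family $(P_t)$ of $n$-gons with $P_1=P$, $[P_t]=[P]_t$; $M(t)$ denotes the monodromy of $P_t$. For $P$ closed, the infinitesimal monodromy is $M'(1)\in\mathfrak{pgl}_2=\mathfrak{gl}_2/F\cdot\mathrm{Id}$ (the tangent vector at $M(1)=\mathrm{Id}$), independent of the lift. *)

theory Defs
  imports
    "HOL-Analysis.Determinants"
    "HOL-Computational_Algebra.Polynomial"
    "HOL-Computational_Algebra.Fraction_Field"
begin

section \<open>The projective line and its projective group over a field\<close>

definition proj_rel :: "'k::field^2 \<Rightarrow> 'k^2 \<Rightarrow> bool" where
  "proj_rel u v \<longleftrightarrow> u \<noteq> 0 \<and> v \<noteq> 0 \<and> (\<exists>c. c \<noteq> 0 \<and> u = c *s v)"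

lemma part_equivp_proj_rel: "part_equivp (proj_rel :: 'k::field^2 \<Rightarrow> 'k^2 \<Rightarrow> bool)"
proof (rule part_equivpI)
  have "proj_rel (1::'k^2) 1"
    unfolding proj_rel_def by (auto simp: vec_eq_iff intro: exI[of _ 1])
  then show "\<exists>x :: 'k^2. proj_rel x x" ..
  show "symp (proj_rel :: 'k^2 \<Rightarrow> 'k^2 \<Rightarrow> bool)"
  proof (rule sympI)
    fix u v :: "'k^2" assume "proj_rel u v"
    then obtain c where c: "u \<noteq> 0" "v \<noteq> 0" "c \<noteq> 0" "u = c *s v"
      by (auto simp: proj_rel_def)
    then have "v = inverse c *s u" by (simp add: vector_smult_assoc)
    with c show "proj_rel v u"
      unfolding proj_rel_def by (metis inverse_nonzero_iff_nonzero)
  qed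
  show "transp (proj_rel :: 'k^2 \<Rightarrow> 'k^2 \<Rightarrow> bool)"
  proof (rule transpI)
    fix u v w :: "'k^2" assume "proj_rel u v" "proj_rel v w"
    then obtain c d where "u \<noteq> 0" "w \<noteq> 0" "c \<noteq> 0" "d \<noteq> 0" "u = c *s v" "v = d *s w"
      by (auto simp: proj_rel_def)
    then show "proj_rel u w"
      unfolding proj_rel_def by (metis mult_eq_0_iff vector_smult_assoc)
  qed
qed

quotient_type (overloaded) 'k proj_line = "'k::field^2" / partial: proj_rel
  by (rule part_equivp_proj_rel)

text \<open>The scalar multiple of a matrix \<open>A\<close> by \<open>c\<close> is written \<open>mat c ** A\<close> throughout.\<close>

definition pgl_rel :: "'k::field^2^2 \<Rightarrow> 'k^2^2 \<Rightarrow> bool" where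
  "pgl_rel A B \<longleftrightarrow> invertible A \<and> invertible B \<and> (\<exists>c. c \<noteq> 0 \<and> A = mat c ** B)"

lemma mat_mult_mat: "mat a ** mat b = (mat (a * b) :: 'k::field^2^2)"
  by (simp add: vec_eq_iff matrix_matrix_mult_def mat_def sum_2 forall_2)

lemma mat_mult_vec: "mat c *v v = c *s (v :: 'k::field^2)"
  by (simp add: vec_eq_iff matrix_vector_mult_def mat_def sum_2 forall_2)

lemma part_equivp_pgl_rel: "part_equivp (pgl_rel :: 'k::field^2^2 \<Rightarrow> 'k^2^2 \<Rightarrow> bool)"
proof (rule part_equivpI)
  have "pgl_rel (mat 1 :: 'k^2^2) (mat 1)"
    unfolding pgl_rel_def by (auto simp: invertible_def intro: exI[of _ 1] exI[of _ "mat 1"])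
  then show "\<exists>A :: 'k^2^2. pgl_rel A A" ..
  show "symp (pgl_rel :: 'k^2^2 \<Rightarrow> 'k^2^2 \<Rightarrow> bool)"
  proof (rule sympI)
    fix A B :: "'k^2^2" assume "pgl_rel A B"
    then obtain c where c: "invertible A" "invertible B" "c \<noteq> 0" "A = mat c ** B"
      by (auto simp: pgl_rel_def)
    then have "B = mat (inverse c) ** A"
      by (simp add: matrix_mul_assoc mat_mult_mat)
    with c show "pgl_rel B A"
      unfolding pgl_rel_def by (metis inverse_nonzero_iff_nonzero)
  qed
  show "transp (pgl_rel :: 'k^2^2 \<Rightarrow> 'k^2^2 \<Rightarrow> bool)"
  proof (rule transpI)
    fix A B C :: "'k^2^2" assume "pgl_rel A B" "pgl_rel B C"
    then obtain c d where "invertible A" "invertible C" "c \<noteq> 0" "d \<noteq> 0"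
        "A = mat c ** B" "B = mat d ** C"
      by (auto simp: pgl_rel_def)
    then show "pgl_rel A C"
      unfolding pgl_rel_def by (metis mult_eq_0_iff matrix_mul_assoc mat_mult_mat)
  qed
qed

quotient_type (overloaded) 'k pgl = "'k::field^2^2" / partial: pgl_rel
  by (rule part_equivp_pgl_rel)

text \<open>
  \<open>point v\<close> is meaningful only for \<open>v \<noteq> 0\<close>, and \<open>pgl_class A\<close> only for invertible \<open>A\<close>.
\<close>

definition point :: "'k::field^2 \<Rightarrow> 'k proj_line" where
  "point = abs_proj_line"

definition pgl_class :: "'k::field^2^2 \<Rightarrow> 'k pgl" where
  "pgl_class = abs_pgl"

definition affine_point :: "'k::field \<Rightarrow> 'k proj_line" where
  "affine_point x = point (vector [x, 1])"

definition pgl_id :: "'k::field pgl" where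
  "pgl_id = pgl_class (mat 1)"

lift_definition pgl_apply :: "'k::field pgl \<Rightarrow> 'k proj_line \<Rightarrow> 'k proj_line" is "\<lambda>A v. A *v v"
proof -
  fix A B :: "'k^2^2" and u v :: "'k^2"
  assume AB: "pgl_rel A B" and uv: "proj_rel u v"
  have inj: "C *v w \<noteq> 0" if "invertible C" "w \<noteq> 0" for C :: "'k^2^2" and w
    using that by (metis invertible_def matrix_vector_mul_assoc matrix_vector_mul_lid
        matrix_vector_mult_0_right)
  obtain c where c: "c \<noteq> 0" "A = mat c ** B" using AB by (auto simp: pgl_rel_def)
  obtain d where d: "d \<noteq> 0" "u = d *s v" using uv by (auto simp: proj_rel_def)
  have "A *v u = c *s (B *v (d *s v))"
    by (simp add: c d mat_mult_vec flip: matrix_vector_mul_assoc)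
  also have "\<dots> = (c * d) *s (B *v v)"
    by (simp add: vector_scalar_commute vector_smult_assoc)
  finally show "proj_rel (A *v u) (B *v v)"
    using AB uv c d inj unfolding proj_rel_def pgl_rel_def by (metis mult_eq_0_iff)
qed

text \<open>
  For points with homogeneous coordinates \<open>(a, 1)\<close> and \<open>(b, 1)\<close> the bracket is \<open>a - b\<close>, so in affine
  coordinates the cross-ratio below is \<open>(a - c) / (a - d) * ((b - d) / (b - c))\<close>.
\<close>

definition bracket :: "'k::field^2 \<Rightarrow> 'k^2 \<Rightarrow> 'k" where
  "bracket u v = u $ 1 * v $ 2 - v $ 1 * u $ 2"

lemma bracket_scale: "bracket (a *s u) (b *s v) = (a * b) * bracket u v"
  by (simp add: bracket_def algebra_simps)

lift_definition cross_ratio ::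
    "'k::field proj_line \<Rightarrow> 'k proj_line \<Rightarrow> 'k proj_line \<Rightarrow> 'k proj_line \<Rightarrow> 'k"
  is "\<lambda>a b c d. bracket a c / bracket a d * (bracket b d / bracket b c)"
  by (auto simp: proj_rel_def bracket_scale)

lemma proj_rel_affine: "proj_rel (vector [x, 1]) (vector [x, 1 :: 'k::field])"
proof -
  have "(vector [x, 1] :: 'k^2) $ 2 \<noteq> 0 $ 2" by (simp add: vector_2)
  then have "(vector [x, 1] :: 'k^2) \<noteq> 0" by metis
  then show ?thesis unfolding proj_rel_def by (metis vector_smult_lid zero_neq_one)
qed

lemma cross_ratio_affine:
  "cross_ratio (affine_point a) (affine_point b) (affine_point c) (affine_point d)
    = (a - c) / (a - d) * ((b - d) / (b - c))"
  unfolding affine_point_def point_def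
  by (simp add: cross_ratio.abs_eq proj_rel_affine bracket_def vector_2)


section \<open>The Lie algebra of the projective group\<close>

definition pgl_lie_rel :: "'k::field^2^2 \<Rightarrow> 'k^2^2 \<Rightarrow> bool" where
  "pgl_lie_rel A B \<longleftrightarrow> (\<exists>c. A - B = mat c)"

lemma equivp_pgl_lie_rel: "equivp (pgl_lie_rel :: 'k::field^2^2 \<Rightarrow> 'k^2^2 \<Rightarrow> bool)"
proof (rule equivpI)
  have m: "mat a - mat b = (mat (a - b) :: 'k^2^2)" "mat 0 = (0 :: 'k^2^2)" for a b
    by (simp_all add: mat_def vec_eq_iff)
  show "reflp (pgl_lie_rel :: 'k^2^2 \<Rightarrow> 'k^2^2 \<Rightarrow> bool)"
    by (rule reflpI) (use m in \<open>auto simp: pgl_lie_rel_def intro: exI[of _ 0]\<close>)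
  show "symp (pgl_lie_rel :: 'k^2^2 \<Rightarrow> 'k^2^2 \<Rightarrow> bool)"
  proof (rule sympI)
    fix A B :: "'k^2^2" assume "pgl_lie_rel A B"
    then obtain c where "A - B = mat c" by (auto simp: pgl_lie_rel_def)
    then have "B - A = mat 0 - mat c" by (metis m(2) diff_0 minus_diff_eq)
    then show "pgl_lie_rel B A" unfolding pgl_lie_rel_def m(1) by blast
  qed
  show "transp (pgl_lie_rel :: 'k^2^2 \<Rightarrow> 'k^2^2 \<Rightarrow> bool)"
  proof (rule transpI)
    fix A B C :: "'k^2^2" assume "pgl_lie_rel A B" "pgl_lie_rel B C"
    then obtain c d where cd: "A - B = mat c" "B - C = mat d" by (auto simp: pgl_lie_rel_def)
    have "A - C = (A - B) + (B - C)" by simp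
    also have "\<dots> = mat (c + d)" unfolding cd by (simp add: mat_def vec_eq_iff)
    finally show "pgl_lie_rel A C" unfolding pgl_lie_rel_def by blast
  qed
qed

quotient_type (overloaded) 'k pgl_lie = "'k::field^2^2" / pgl_lie_rel
  by (rule equivp_pgl_lie_rel)

definition pgl_lie_class :: "'k::field^2^2 \<Rightarrow> 'k pgl_lie" where
  "pgl_lie_class = abs_pgl_lie"

lift_definition pgl_lie_eigenvector :: "'k::field pgl_lie \<Rightarrow> 'k^2 \<Rightarrow> bool"
  is "\<lambda>A v. v \<noteq> 0 \<and> (\<exists>l. A *v v = l *s v)"
proof -
  have *: "\<exists>l. B *v v = l *s v" if "A - B = mat c" "A *v v = l *s v"
    for A B :: "'k^2^2" and v c l
  proof -
    have "A *v v - B *v v = c *s v"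
      by (metis that(1) mat_mult_vec matrix_vector_mult_diff_rdistrib)
    then have "B *v v = (l - c) *s v"
      by (simp add: that(2) vector_sub_rdistrib algebra_simps)
    then show ?thesis ..
  qed
  fix A B :: "'k^2^2" assume AB: "pgl_lie_rel A B"
  then have BA: "pgl_lie_rel B A" using equivp_pgl_lie_rel by (metis equivp_symp)
  obtain c d where cd: "A - B = mat c" "B - A = mat d"
    using AB BA by (auto simp: pgl_lie_rel_def)
  have "(\<exists>l. A *v v = l *s v) = (\<exists>l. B *v v = l *s v)" for v
    using *[OF cd(1)] *[OF cd(2)] by metis
  then show "(\<lambda>v. v \<noteq> 0 \<and> (\<exists>l. A *v v = l *s v)) = (\<lambda>v. v \<noteq> 0 \<and> (\<exists>l. B *v v = l *s v))"
    by simp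
qed


section \<open>Twisted polygons\<close>

definition twisted_ngon :: "nat \<Rightarrow> (int \<Rightarrow> 'k::field proj_line) \<Rightarrow> 'k pgl \<Rightarrow> bool" where
  "twisted_ngon n p M \<longleftrightarrow>
     (\<forall>i. p (i + int n) = pgl_apply M (p i)) \<and>
     (\<forall>i. p i \<noteq> p (i + 1) \<and> p (i + 1) \<noteq> p (i + 2) \<and> p i \<noteq> p (i + 2))"

definition closed_ngon :: "nat \<Rightarrow> (int \<Rightarrow> 'k::field proj_line) \<Rightarrow> bool" where
  "closed_ngon n p \<longleftrightarrow> twisted_ngon n p pgl_id"

definition cross_ratio_coord :: "(int \<Rightarrow> 'k::field proj_line) \<Rightarrow> int \<Rightarrow> 'k" where
  "cross_ratio_coord p i = cross_ratio (p i) (p (i + 1)) (p (i - 1)) (p (i + 2))"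

definition discrete_curvature :: "nat \<Rightarrow> (int \<Rightarrow> 'k::field) \<Rightarrow> bool" where
  "discrete_curvature n \<mu> \<longleftrightarrow> (\<forall>i. \<mu> i \<noteq> 0 \<and> \<mu> (i + int n) = \<mu> i)"


section \<open>The scaling symmetry\<close>

definition scaled_curvature :: "'k::field \<Rightarrow> 'k \<Rightarrow> 'k \<Rightarrow> 'k" where
  "scaled_curvature \<eta> t m = t * m / (1 + (t - 1) * \<eta> * m)"

definition scaled_coord :: "'k::field \<Rightarrow> 'k \<Rightarrow> 'k \<Rightarrow> 'k \<Rightarrow> 'k" where
  "scaled_coord \<eta> t m c = c * (t * m / scaled_curvature \<eta> t m)"


section \<open>Algebraic families near the parameter value 1\<close>

text \<open>
  A family depending algebraically on a parameter \<open>t\<close> near \<open>t = 1\<close> is an object over the field of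
  rational functions \<open>F(t)\<close> that is regular at \<open>t = 1\<close>. A morphism from a neighbourhood of \<open>1\<close> in
  the line to the projective line is given by two polynomials not vanishing simultaneously at \<open>1\<close>;
  a morphism to the projective group is given by a matrix of polynomials that is invertible at \<open>1\<close>.
  Working with formal rational functions rather than with functions on \<open>F\<close> keeps the notion
  meaningful over finite fields.
\<close>

definition rat_of_poly :: "'a::field poly \<Rightarrow> 'a poly fract" where
  "rat_of_poly q = Fraction_Field.Fract q 1"

definition rat_const :: "'a::field \<Rightarrow> 'a poly fract" where
  "rat_const a = rat_of_poly [:a:]"

definition rat_t :: "'a::field poly fract" where
  "rat_t = rat_of_poly [:0, 1:]"

definition rat_vec :: "'a::field poly^2 \<Rightarrow> 'a poly fract^2" where
  "rat_vec v = (\<chi> i. rat_of_poly (v $ i))"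

definition rat_mat :: "'a::field poly^2^2 \<Rightarrow> 'a poly fract^2^2" where
  "rat_mat A = (\<chi> i j. rat_of_poly (A $ i $ j))"

definition vec_at_1 :: "'a::field poly^2 \<Rightarrow> 'a^2" where
  "vec_at_1 v = (\<chi> i. poly (v $ i) 1)"

definition mat_at_1 :: "'a::field poly^2^2 \<Rightarrow> 'a^2^2" where
  "mat_at_1 A = (\<chi> i j. poly (A $ i $ j) 1)"

definition mat_pderiv :: "'a::field poly^2^2 \<Rightarrow> 'a poly^2^2" where
  "mat_pderiv A = (\<chi> i j. pderiv (A $ i $ j))"

definition point_has_value_at_1 ::
    "'a::field poly fract proj_line \<Rightarrow> 'a proj_line \<Rightarrow> bool" where
  "point_has_value_at_1 x y \<longleftrightarrow>
     (\<exists>v. vec_at_1 v \<noteq> 0 \<and> x = point (rat_vec v) \<and> y = point (vec_at_1 v))"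

definition pgl_has_value_at_1 :: "'a::field poly fract pgl \<Rightarrow> 'a pgl \<Rightarrow> bool" where
  "pgl_has_value_at_1 M N \<longleftrightarrow>
     (\<exists>A. invertible (mat_at_1 A) \<and> M = pgl_class (rat_mat A) \<and> N = pgl_class (mat_at_1 A))"

text \<open>
  The derivative \<open>M'(1)\<close> of a family \<open>M\<close> in the projective group with \<open>M(1) = Id\<close>: choose
  a matrix representative \<open>A(t)\<close> with \<open>A(1) = Id\<close> and differentiate. Two such representatives
  differ by a scalar rational function with value \<open>1\<close> at \<open>t = 1\<close>, which changes \<open>A'(1)\<close> by
  a scalar matrix only, so the class of \<open>A'(1)\<close> is unique.
\<close>

definition pgl_derivative_at_1 :: "'a::field poly fract pgl \<Rightarrow> 'a pgl_lie" where
  "pgl_derivative_at_1 M =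
     (THE D. \<exists>A. mat_at_1 A = mat 1 \<and> M = pgl_class (rat_mat A) \<and>
                 D = pgl_lie_class (mat_at_1 (mat_pderiv A)))"

text \<open>
  \<open>(Pt, Mt)\<close> is a lift of the deformation of the polygon \<open>(P, M)\<close> with curvature \<open>\<mu>\<close>. Being
  a twisted polygon is an open condition, so it is required over \<open>F(t)\<close>, i.e. for generic \<open>t\<close>, and
  it holds at \<open>t = 1\<close> because the value there is \<open>(P, M)\<close>.
\<close>

definition is_lift ::
    "nat \<Rightarrow> 'a::field \<Rightarrow> (int \<Rightarrow> 'a) \<Rightarrow> (int \<Rightarrow> 'a proj_line) \<Rightarrow> 'a pgl \<Rightarrow>
     (int \<Rightarrow> 'a poly fract proj_line) \<Rightarrow> 'a poly fract pgl \<Rightarrow> bool" where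
  "is_lift n \<eta> \<mu> P M Pt Mt \<longleftrightarrow>
     twisted_ngon n Pt Mt \<and>
     (\<forall>i. point_has_value_at_1 (Pt i) (P i)) \<and> pgl_has_value_at_1 Mt M \<and>
     (\<forall>i. cross_ratio_coord Pt i =
            scaled_coord (rat_const \<eta>) rat_t (rat_const (\<mu> i)) (rat_const (cross_ratio_coord P i)))"

end

theory Submission
  imports Defs
begin

text \<open>
  Let \<open>H i (t) = mat 1 + (t - 1) * \<eta> * \<mu> i * E i\<close>, where \<open>E i\<close> is the projection onto the line of
  \<open>p i\<close> along that of \<open>p (i + 1)\<close>. This shear fixes \<open>p i\<close> and \<open>p (i + 1)\<close> and has eigenvalue ratio
  \<open>1 + (t - 1) * \<eta> * \<mu> i\<close>, which is exactly the factor by which the scaling symmetry multiplies the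
  coordinate \<open>c i\<close>. Bending the closed polygon successively along its edges, that is moving \<open>p j\<close> by
  \<open>H 1 \<cdots> H j\<close>, therefore multiplies every coordinate by the required factor: each shear leaves the
  two vertices of its edge in place and moves the following part of the polygon relative to the preceding one
  (\<open>cross_ratio_shear\<close>, \<open>development_is_lift\<close>). The result is a lift with monodromy \<open>H 1 \<cdots> H n\<close>.
  As every factor is the identity at \<open>t = 1\<close>, the derivative there is the sum of the \<open>\<eta> * \<mu> i * E i\<close>,
  and these are the summands in the formula for the infinitesimal monodromy.

  Any other lift has the same coordinates, so it is the image of this one under a projective map
  over the rational functions (\<open>ngon_determined_by_cross_ratios\<close>), and its monodromy is
  conjugate. The two lifts have the same value at \<open>t = 1\<close>, so the conjugating map is the identity
  there, and conjugating by it does not change the derivative of a family passing through the identity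
  (\<open>derivative_independent_of_lift\<close>).

  A vector \<open>v\<close> is an eigenvector of a matrix \<open>A\<close> when \<open>A *v v\<close> and \<open>v\<close> are linearly dependent,
  that is when their bracket vanishes. The bracket of \<open>E i *v v\<close> with \<open>v = (X, Y)\<close> is the \<open>i\<close>-th term of
  the quadratic form up to sign and the weight \<open>\<mu> i\<close>.
\<close>

section \<open>Points and projective maps through representatives\<close>

lemma vec2_eq_iff: "u = v \<longleftrightarrow> u $ 1 = v $ 1 \<and> u $ 2 = (v :: 'b^2) $ 2"
  by (simp add: vec_eq_iff forall_2)

lemma mat2_eq_iff:
  "A = B \<longleftrightarrow> A $ 1 $ 1 = B $ 1 $ 1 \<and> A $ 1 $ 2 = B $ 1 $ 2 \<and>
    A $ 2 $ 1 = B $ 2 $ 1 \<and> A $ 2 $ 2 = (B :: 'b^2^2) $ 2 $ 2"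
  by (auto simp: vec_eq_iff forall_2)

lemma mat2_vec_component:
  "(A *v v) $ i = A $ i $ 1 * v $ 1 + A $ i $ 2 * (v :: 'b::semiring_1^2) $ 2"
  by (simp add: matrix_vector_mult_def sum_2)

lemma mat2_mult_component:
  "(A ** B) $ i $ j = A $ i $ 1 * B $ 1 $ j + A $ i $ 2 * (B :: 'b::semiring_1^2^2) $ 2 $ j"
  by (simp add: matrix_matrix_mult_def sum_2)

lemma mat2_component:
  "mat c $ (1::2) $ (1::2) = c" "mat c $ (1::2) $ (2::2) = 0"
  "mat c $ (2::2) $ (1::2) = 0" "mat c $ (2::2) $ (2::2) = (c :: 'b::zero)"
  by (simp_all add: mat_def)

lemmas mat2_simps = vec2_eq_iff mat2_eq_iff mat2_vec_component mat2_mult_component mat2_component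
  vector_2

lemma mat_commutes: "A ** mat c = mat c ** (A :: 'b::comm_ring_1^2^2)"
  by (simp add: mat2_simps mult.commute)

lemma bracket_eq_0_iff:
  assumes "v \<noteq> 0"
  shows "bracket u v = 0 \<longleftrightarrow> (\<exists>l. u = l *s v)"
proof
  assume *: "bracket u v = 0"
  show "\<exists>l. u = l *s v"
  proof (cases "v $ 1 = 0")
    case True
    with assms have "v $ 2 \<noteq> 0" by (auto simp: mat2_simps)
    with True * show ?thesis
      by (intro exI[of _ "u $ 2 / v $ 2"]) (auto simp: mat2_simps bracket_def)
  next
    case False
    with * show ?thesis
      by (intro exI[of _ "u $ 1 / v $ 1"]) (auto simp: mat2_simps bracket_def field_simps)
  qed
qed (auto simp: bracket_def)

lemma bracket_mat: "bracket (A *v u) (A *v v) = det A * bracket u v"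
  by (simp add: bracket_def det_2 mat2_simps algebra_simps)

lemma invertible_vec_nonzero:
  "invertible A \<Longrightarrow> v \<noteq> 0 \<Longrightarrow> A *v v \<noteq> (0 :: 'b::field^2)"
  by (metis invertible_def matrix_vector_mul_assoc matrix_vector_mul_lid matrix_vector_mult_0_right)

lemma proj_rel_iff_bracket:
  assumes "u \<noteq> 0" "v \<noteq> 0"
  shows "proj_rel u v \<longleftrightarrow> bracket u v = 0"
proof -
  have "l \<noteq> 0" if "u = l *s v" for l
    using assms that by auto
  then show ?thesis
    using assms by (auto simp: proj_rel_def bracket_eq_0_iff)
qed

lemma proj_rel_refl: "v \<noteq> 0 \<Longrightarrow> proj_rel v v"
  by (simp add: proj_rel_iff_bracket bracket_def)

lemma point_eq_iff_bracket:
  assumes "u \<noteq> 0" "v \<noteq> 0"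
  shows "point u = point v \<longleftrightarrow> bracket u v = 0"
  unfolding point_def
  by (metis Quotient3_rel[OF Quotient3_proj_line] assms proj_rel_iff_bracket proj_rel_refl)

lemma point_scale: "c \<noteq> 0 \<Longrightarrow> v \<noteq> 0 \<Longrightarrow> point (c *s v) = point v"
  by (subst point_eq_iff_bracket) (auto simp: bracket_def mat2_simps)

lemma point_cases:
  obtains v where "v \<noteq> 0" "x = point v"
  by (metis Quotient3_abs_rep[OF Quotient3_proj_line] Quotient3_rep_reflp[OF Quotient3_proj_line]
      point_def proj_rel_def)

lemma pgl_rel_refl: "invertible A \<Longrightarrow> pgl_rel A (A :: 'b::field^2^2)"
  unfolding pgl_rel_def by (intro conjI exI[of _ 1]) auto

lemma pgl_class_eq_iff:
  assumes "invertible A" "invertible B"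
  shows "pgl_class A = pgl_class B \<longleftrightarrow> (\<exists>c. c \<noteq> 0 \<and> A = mat c ** B)"
  unfolding pgl_class_def
  using Quotient3_rel[OF Quotient3_pgl, of A B] pgl_rel_refl assms
  by (auto simp: pgl_rel_def)

lemma pgl_apply_class:
  "invertible A \<Longrightarrow> v \<noteq> 0 \<Longrightarrow> pgl_apply (pgl_class A) (point v) = point (A *v v)"
  unfolding pgl_class_def point_def
  by (simp add: pgl_apply.abs_eq pgl_rel_refl proj_rel_refl)

lemma pgl_apply_mult:
  assumes "invertible A" "invertible B"
  shows "pgl_apply (pgl_class (A ** B)) x = pgl_apply (pgl_class A) (pgl_apply (pgl_class B) x)"
proof -
  obtain v where "v \<noteq> 0" "x = point v" by (rule point_cases)
  with assms show ?thesis
    by (simp add: pgl_apply_class invertible_mult invertible_vec_nonzero matrix_vector_mul_assoc)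
qed

lemma pgl_apply_inj:
  assumes "invertible A"
  shows "pgl_apply (pgl_class A) x = pgl_apply (pgl_class A) y \<longleftrightarrow> x = y"
proof -
  obtain u where u: "u \<noteq> 0" "x = point u" by (rule point_cases)
  obtain v where v: "v \<noteq> 0" "y = point v" by (rule point_cases)
  have "det A \<noteq> 0" using assms by (simp add: invertible_det_nz)
  with assms u v show ?thesis
    by (simp add: pgl_apply_class point_eq_iff_bracket invertible_vec_nonzero bracket_mat)
qed

lemma cross_ratio_point:
  assumes "a \<noteq> 0" "b \<noteq> 0" "c \<noteq> 0" "d \<noteq> 0"
  shows "cross_ratio (point a) (point b) (point c) (point d)
    = bracket a c / bracket a d * (bracket b d / bracket b c)"
  using assms unfolding point_def by (simp add: cross_ratio.abs_eq proj_rel_refl)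

lemma cross_ratio_pgl_apply:
  assumes "invertible A"
  shows "cross_ratio (pgl_apply (pgl_class A) a) (pgl_apply (pgl_class A) b)
      (pgl_apply (pgl_class A) c) (pgl_apply (pgl_class A) d) = cross_ratio a b c d"
proof -
  obtain u v where "u \<noteq> 0" "a = point u" "v \<noteq> 0" "b = point v"
    by (metis point_cases)
  moreover obtain w x where "w \<noteq> 0" "c = point w" "x \<noteq> 0" "d = point x"
    by (metis point_cases)
  moreover have "det A \<noteq> 0" using assms by (simp add: invertible_det_nz)
  ultimately show ?thesis
    using assms
    by (simp add: pgl_apply_class cross_ratio_point invertible_vec_nonzero bracket_mat)
qed

text \<open>
  Moving \<open>a\<close> to infinity turns the cross-ratio into an injective affine function of the
  coordinate of its last argument.
\<close>

lemma cross_ratio_determines_point: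
  assumes "a \<noteq> b" "c \<noteq> a" "c \<noteq> b" "a \<noteq> d" "a \<noteq> d'"
    and eq: "cross_ratio a b c d = cross_ratio a b c d'"
  shows "d = d'"
proof -
  obtain u v where "u \<noteq> 0" "a = point u" "v \<noteq> 0" "b = point v"
    by (metis point_cases)
  moreover obtain w x where "w \<noteq> 0" "c = point w" "x \<noteq> 0" "d = point x"
    by (metis point_cases)
  moreover obtain y where "y \<noteq> 0" "d' = point y"
    by (rule point_cases)
  ultimately have r: "u \<noteq> 0" "a = point u" "v \<noteq> 0" "b = point v"
    "w \<noteq> 0" "c = point w" "x \<noteq> 0" "d = point x" "y \<noteq> 0" "d' = point y"
    by auto
  have nz: "bracket u v \<noteq> 0" "bracket w u \<noteq> 0" "bracket w v \<noteq> 0" "bracket u x \<noteq> 0" "bracket u y \<noteq> 0"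
    using assms(1-5) r by (auto simp: point_eq_iff_bracket)
  then have nz': "bracket u w \<noteq> 0" "bracket v w \<noteq> 0"
    by (auto simp: bracket_def)
  have "bracket v x * bracket u y = bracket v y * bracket u x"
    using eq r nz nz' by (simp add: cross_ratio_point field_simps)
  \<comment> \<open>The Pluecker relation among \<open>u, v, x, y\<close>.\<close>
  moreover have "bracket v x * bracket u y - bracket v y * bracket u x = - bracket u v * bracket x y"
    by (simp add: bracket_def algebra_simps)
  ultimately have "bracket x y = 0" using nz by simp
  then show ?thesis using r by (simp add: point_eq_iff_bracket)
qed

text \<open>
  Two maps agreeing on the points \<open>x, y, z\<close> are proportional on each of three lines, with factors
  \<open>k, l, m\<close>. A vector of the third line is a combination of vectors of the first two with nonzero
  coefficients, which forces the factors to coincide.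
\<close>

lemma pgl_eq_if_agree_on_frame:
  assumes inv: "invertible A" "invertible B"
    and distinct: "x \<noteq> y" "y \<noteq> z" "x \<noteq> z"
    and eq: "\<And>w. w \<in> {x, y, z} \<Longrightarrow> pgl_apply (pgl_class A) w = pgl_apply (pgl_class B) w"
  shows "pgl_class A = (pgl_class B :: 'b::field pgl)"
proof -
  obtain u v w where r: "u \<noteq> 0" "x = point u" "v \<noteq> 0" "y = point v" "w \<noteq> 0" "z = point w"
    by (metis point_cases)
  have nz: "bracket u v \<noteq> 0" "bracket v w \<noteq> 0" "bracket u w \<noteq> 0"
    using distinct r by (auto simp: point_eq_iff_bracket)
  have "\<exists>l. A *v q = l *s (B *v q)" if "q \<noteq> 0" "point q \<in> {x, y, z}" for q
    using eq[OF that(2)] that(1) inv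
    by (simp add: pgl_apply_class point_eq_iff_bracket invertible_vec_nonzero bracket_eq_0_iff)
  then obtain k l m where klm: "A *v u = k *s (B *v u)" "A *v v = l *s (B *v v)" "A *v w = m *s (B *v w)"
    using r by (metis insertI1 insertI2)
  \<comment> \<open>Cramer's rule expresses \<open>w\<close> in the basis \<open>u, v\<close>.\<close>
  have exp: "bracket u v *s w = bracket w v *s u + bracket u w *s v"
    by (simp add: mat2_simps bracket_def algebra_simps)
  have "bracket w v *s (A *v u) + bracket u w *s (A *v v) = bracket u v *s (A *v w)"
    by (simp add: exp matrix_vector_right_distrib flip: vector_scalar_commute)
  also have "\<dots> = m *s (B *v (bracket u v *s w))"
    by (simp add: klm vector_scalar_commute mult.commute)
  finally have comb: "B *v ((k - m) * bracket w v *s u + (l - m) * bracket u w *s v) = 0"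
    unfolding klm exp by (simp add: mat2_simps algebra_simps)
  then have "(k - m) * bracket w v *s u + (l - m) * bracket u w *s v = 0"
    using inv(2) invertible_vec_nonzero by blast
  then have "bracket ((k - m) * bracket w v *s u + (l - m) * bracket u w *s v) v = 0"
    "bracket u ((k - m) * bracket w v *s u + (l - m) * bracket u w *s v) = 0"
    by (simp_all add: bracket_def)
  moreover have "bracket ((k - m) * bracket w v *s u + (l - m) * bracket u w *s v) v
      = (k - m) * bracket w v * bracket u v"
    "bracket u ((k - m) * bracket w v *s u + (l - m) * bracket u w *s v)
      = (l - m) * bracket u w * bracket u v"
    by (simp_all add: bracket_def algebra_simps)
  moreover have "bracket w v \<noteq> 0" using nz by (auto simp: bracket_def)
  ultimately have "k = m" "l = m" using nz by auto
  then have kl: "(A - mat m ** B) *v u = 0" "(A - mat m ** B) *v v = 0"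
    using klm
    by (simp_all add: matrix_vector_mult_diff_rdistrib mat_mult_vec flip: matrix_vector_mul_assoc)
  have "A - mat m ** B = 0"
  proof -
    \<comment> \<open>Cramer's rule: a matrix is recovered from its values on the basis \<open>u, v\<close>.\<close>
    define D where "D = A - mat m ** B"
    have "bracket u v * D $ i $ 1 = v $ 2 * (D *v u) $ i - u $ 2 * (D *v v) $ i"
      "bracket u v * D $ i $ 2 = u $ 1 * (D *v v) $ i - v $ 1 * (D *v u) $ i" for i
      by (simp_all add: bracket_def mat2_simps algebra_simps)
    then have "D $ i $ 1 = 0" "D $ i $ 2 = 0" for i
      using kl nz by (simp_all flip: D_def)
    then show ?thesis by (simp add: D_def mat2_simps del: vector_minus_component)
  qed
  then have Am: "A = mat m ** B" by simp
  have "m \<noteq> 0"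
  proof
    assume "m = 0"
    then have "A *v u = 0" using klm \<open>k = m\<close> by simp
    then show False using inv r invertible_vec_nonzero by blast
  qed
  with Am inv show ?thesis by (auto simp: pgl_class_eq_iff)
qed

text \<open>
  Rigidity: three consecutive vertices form a projective frame, and each coordinate determines
  the next vertex from the preceding three, so a projective map matching one frame matches the rest.
\<close>

lemma ngon_determined_by_cross_ratios:
  fixes P Q :: "int \<Rightarrow> 'b::field proj_line"
  assumes P: "twisted_ngon n P M" and Q: "twisted_ngon n Q N"
    and c: "\<And>i. cross_ratio_coord Q i = cross_ratio_coord P i"
    and inv: "invertible B"
    and frame: "\<And>i. i \<in> {0, 1, 2} \<Longrightarrow> pgl_apply (pgl_class B) (Q i) = P i"
  shows "pgl_apply (pgl_class B) (Q (int k)) = P (int k)"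
proof (induction k rule: less_induct)
  case (less k)
  show ?case
  proof (cases "k < 3")
    case True
    then have "int k \<in> {0, 1, 2}" by auto
    then show ?thesis by (rule frame)
  next
    case False
    define i where "i = int k - 2"
    have IH: "pgl_apply (pgl_class B) (Q j) = P j" if "0 \<le> j" "j < int k" for j
      using less[of "nat j"] that by auto
    have eqs: "pgl_apply (pgl_class B) (Q i) = P i" "pgl_apply (pgl_class B) (Q (i + 1)) = P (i + 1)"
      "pgl_apply (pgl_class B) (Q (i - 1)) = P (i - 1)"
      using False by (auto simp: i_def intro!: IH)
    have P': "P i \<noteq> P (i + 1)" "P (i - 1) \<noteq> P i" "P (i - 1) \<noteq> P (i + 1)" "P i \<noteq> P (i + 2)"
      using P[unfolded twisted_ngon_def, THEN conjunct2, rule_format, of i]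
        P[unfolded twisted_ngon_def, THEN conjunct2, rule_format, of "i - 1"]
      by (simp_all add: algebra_simps)
    have "Q i \<noteq> Q (i + 2)" using Q by (auto simp: twisted_ngon_def)
    then have "P i \<noteq> pgl_apply (pgl_class B) (Q (i + 2))"
      using inv by (simp add: pgl_apply_inj flip: eqs)
    moreover have "cross_ratio (P i) (P (i + 1)) (P (i - 1)) (pgl_apply (pgl_class B) (Q (i + 2)))
      = cross_ratio (P i) (P (i + 1)) (P (i - 1)) (P (i + 2))"
      using c[of i] cross_ratio_pgl_apply[OF inv, of "Q i" "Q (i + 1)" "Q (i - 1)" "Q (i + 2)"]
      by (simp add: cross_ratio_coord_def eqs)
    ultimately have "pgl_apply (pgl_class B) (Q (i + 2)) = P (i + 2)"
      using P' by (intro cross_ratio_determines_point[of "P i" "P (i + 1)" "P (i - 1)"]) auto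
    then show ?thesis by (simp add: i_def)
  qed
qed

section \<open>Rational functions and their values at 1\<close>

lemma rat_of_poly_simps:
  "rat_of_poly 0 = 0" "rat_of_poly 1 = 1"
  "rat_of_poly (f + g) = rat_of_poly f + rat_of_poly g"
  "rat_of_poly (- f) = - rat_of_poly f"
  "rat_of_poly (f - g) = rat_of_poly f - rat_of_poly g"
  "rat_of_poly (f * g) = rat_of_poly f * rat_of_poly g"
  by (simp_all add: rat_of_poly_def Zero_fract_def One_fract_def)

lemma rat_of_poly_eq_iff: "rat_of_poly f = rat_of_poly g \<longleftrightarrow> f = g"
  by (simp add: rat_of_poly_def eq_fract)

lemma rat_of_poly_eq_0_iff: "rat_of_poly f = 0 \<longleftrightarrow> f = 0"
  using rat_of_poly_eq_iff[of f 0] by (simp add: rat_of_poly_simps)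

lemma rat_of_poly_nonzero_if_value: "poly f 1 \<noteq> 0 \<Longrightarrow> rat_of_poly f \<noteq> 0"
  by (auto simp: rat_of_poly_eq_0_iff)

lemma rat_mat_mult: "rat_mat (A ** B) = rat_mat A ** rat_mat B"
  by (simp add: rat_mat_def mat2_simps rat_of_poly_simps)

lemma rat_mat_mat: "rat_mat (mat c) = mat (rat_of_poly c)"
  by (simp add: rat_mat_def mat2_simps rat_of_poly_simps)

lemma rat_vec_mult: "rat_vec (A *v v) = rat_mat A *v rat_vec v"
  by (simp add: rat_mat_def rat_vec_def mat2_simps rat_of_poly_simps)

lemma rat_vec_scale: "rat_vec (c *s v) = rat_of_poly c *s rat_vec v"
  by (simp add: rat_vec_def mat2_simps rat_of_poly_simps)

lemma det_rat_mat: "det (rat_mat A) = rat_of_poly (det A)"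
  by (simp add: rat_mat_def det_2 rat_of_poly_simps)

lemma bracket_rat_vec:
  "bracket (rat_vec u) (rat_vec v) = rat_of_poly (u $ 1 * v $ 2 - v $ 1 * u $ 2)"
  by (simp add: rat_vec_def bracket_def rat_of_poly_simps)

lemma mat_at_1_mult: "mat_at_1 (A ** B) = mat_at_1 A ** mat_at_1 B"
  by (simp add: mat_at_1_def mat2_simps)

lemma mat_at_1_mat: "mat_at_1 (mat c) = mat (poly c 1)"
  by (simp add: mat_at_1_def mat2_simps)

lemma vec_at_1_mult: "vec_at_1 (A *v v) = mat_at_1 A *v vec_at_1 v"
  by (simp add: mat_at_1_def vec_at_1_def mat2_simps)

lemma det_mat_at_1: "det (mat_at_1 A) = poly (det A) 1"
  by (simp add: mat_at_1_def det_2)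

lemma mat_at_1_pderiv_mult:
  "mat_at_1 (mat_pderiv (A ** B)) =
    mat_at_1 (mat_pderiv A) ** mat_at_1 B + mat_at_1 A ** mat_at_1 (mat_pderiv B)"
  by (simp add: mat_at_1_def mat_pderiv_def mat2_simps pderiv_add pderiv_mult)

lemma invertible_rat_mat: "invertible (mat_at_1 A) \<Longrightarrow> invertible (rat_mat A)"
  by (simp add: invertible_det_nz det_rat_mat det_mat_at_1 rat_of_poly_nonzero_if_value)

lemma invertible_mat: "c \<noteq> 0 \<Longrightarrow> invertible (mat c :: 'b::field^2^2)"
  by (simp add: invertible_det_nz det_2 mat2_simps)

lemma rat_vec_nonzero: "vec_at_1 v \<noteq> 0 \<Longrightarrow> rat_vec v \<noteq> 0"
  by (auto simp: rat_vec_def vec_at_1_def mat2_simps rat_of_poly_eq_0_iff)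

text \<open>Distinctness is an open condition: the bracket is a polynomial with nonzero value at \<open>1\<close>.\<close>

lemma points_distinct_if_values_distinct:
  assumes "point_has_value_at_1 x a" "point_has_value_at_1 y b" "a \<noteq> b"
  shows "x \<noteq> y"
proof -
  obtain u where u: "vec_at_1 u \<noteq> 0" "x = point (rat_vec u)" "a = point (vec_at_1 u)"
    using assms(1) by (auto simp: point_has_value_at_1_def)
  obtain v where v: "vec_at_1 v \<noteq> 0" "y = point (rat_vec v)" "b = point (vec_at_1 v)"
    using assms(2) by (auto simp: point_has_value_at_1_def)
  have "bracket (vec_at_1 u) (vec_at_1 v) \<noteq> 0"
    using assms(3) u v by (simp add: point_eq_iff_bracket)
  then have "bracket (rat_vec u) (rat_vec v) \<noteq> 0"
    unfolding bracket_rat_vec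
    by (intro rat_of_poly_nonzero_if_value) (simp add: bracket_def vec_at_1_def)
  then show ?thesis using u v by (simp add: point_eq_iff_bracket rat_vec_nonzero)
qed

text \<open>
  Proportionality of \<open>A\<close> and \<open>B\<close> over the rational functions means that the products
  \<open>A i j * B k l\<close> and \<open>A k l * B i j\<close> of entries agree. These are identities of polynomials and
  can be differentiated at \<open>1\<close>, where only the diagonal entries survive; the unknown factor
  of proportionality never has to be evaluated.
\<close>

lemma derivatives_of_proportional_matrices:
  fixes A B :: "'a::field poly^2^2"
  assumes scale: "rat_mat A = mat c ** rat_mat B"
    and one: "mat_at_1 A = mat k" "mat_at_1 B = mat k" "k \<noteq> 0"
  shows "\<exists>d. mat_at_1 (mat_pderiv A) - mat_at_1 (mat_pderiv B) = mat d"
proof -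
  have entry: "rat_of_poly (A $ i $ j) = c * rat_of_poly (B $ i $ j)" for i j
  proof -
    have "rat_mat A $ i $ j = (mat c ** rat_mat B) $ i $ j" using scale by simp
    moreover have "(mat c ** X) $ i $ j = c * X $ i $ j" for X :: "'a poly fract^2^2"
      by (cases i rule: exhaust_2[THEN disjE]) (auto simp: mat2_simps)
    ultimately show ?thesis by (simp add: rat_mat_def)
  qed
  have "rat_of_poly (A $ i $ j * B $ k $ l) = rat_of_poly (A $ k $ l * B $ i $ j)" for i j k l
    by (simp add: rat_of_poly_simps entry mult.assoc mult.left_commute)
  then have "A $ i $ j * B $ k $ l = A $ k $ l * B $ i $ j" for i j k l
    by (simp only: rat_of_poly_eq_iff)
  then have "poly (pderiv (A $ i $ j * B $ k $ l)) 1 = poly (pderiv (A $ k $ l * B $ i $ j)) 1"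
    for i j k l by simp
  then have d: "poly (A $ i $ j) 1 * poly (pderiv (B $ k $ l)) 1
      + poly (B $ k $ l) 1 * poly (pderiv (A $ i $ j)) 1
    = poly (A $ k $ l) 1 * poly (pderiv (B $ i $ j)) 1
      + poly (B $ i $ j) 1 * poly (pderiv (A $ k $ l)) 1" for i j k l
    by (simp add: pderiv_mult)
  have v: "poly (A $ 1 $ 1) 1 = k" "poly (A $ 1 $ 2) 1 = 0" "poly (A $ 2 $ 1) 1 = 0"
    "poly (A $ 2 $ 2) 1 = k" "poly (B $ 1 $ 1) 1 = k" "poly (B $ 1 $ 2) 1 = 0"
    "poly (B $ 2 $ 1) 1 = 0" "poly (B $ 2 $ 2) 1 = k"
    using one(1,2) by (simp_all add: mat_at_1_def mat2_simps)
  have "k * poly (pderiv (A $ 1 $ 2)) 1 = k * poly (pderiv (B $ 1 $ 2)) 1"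
    "k * poly (pderiv (A $ 2 $ 1)) 1 = k * poly (pderiv (B $ 2 $ 1)) 1"
    "k * poly (pderiv (A $ 1 $ 1)) 1 + k * poly (pderiv (B $ 2 $ 2)) 1
      = k * poly (pderiv (B $ 1 $ 1)) 1 + k * poly (pderiv (A $ 2 $ 2)) 1"
    using d[of 1 2 1 1] d[of 2 1 1 1] d[of 1 1 2 2] by (simp_all add: v add.commute)
  then have "poly (pderiv (A $ 1 $ 2)) 1 = poly (pderiv (B $ 1 $ 2)) 1"
    "poly (pderiv (A $ 2 $ 1)) 1 = poly (pderiv (B $ 2 $ 1)) 1"
    "poly (pderiv (A $ 1 $ 1)) 1 + poly (pderiv (B $ 2 $ 2)) 1
      = poly (pderiv (B $ 1 $ 1)) 1 + poly (pderiv (A $ 2 $ 2)) 1"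
    using \<open>k \<noteq> 0\<close> by (simp_all flip: distrib_left)
  then show ?thesis
    by (intro exI[of _ "poly (pderiv (A $ 1 $ 1)) 1 - poly (pderiv (B $ 1 $ 1)) 1"])
      (simp add: mat_at_1_def mat_pderiv_def mat2_simps algebra_simps)
qed

lemma pgl_lie_class_eq_iff:
  "pgl_lie_class A = pgl_lie_class B \<longleftrightarrow> (\<exists>c. A - B = mat c)"
  unfolding pgl_lie_class_def by (simp add: pgl_lie.abs_eq_iff pgl_lie_rel_def)

text \<open>The derivative may thus be computed from any representative that is the identity at \<open>1\<close>.\<close>

lemma pgl_derivative_at_1_class:
  assumes "mat_at_1 A = mat 1"
  shows "pgl_derivative_at_1 (pgl_class (rat_mat A)) = pgl_lie_class (mat_at_1 (mat_pderiv A))"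
  unfolding pgl_derivative_at_1_def
proof (rule the_equality)
  fix D
  assume "\<exists>B. mat_at_1 B = mat 1 \<and> pgl_class (rat_mat A) = pgl_class (rat_mat B) \<and>
    D = pgl_lie_class (mat_at_1 (mat_pderiv B))"
  then obtain B where B: "mat_at_1 B = mat 1" "pgl_class (rat_mat B) = pgl_class (rat_mat A)"
    "D = pgl_lie_class (mat_at_1 (mat_pderiv B))" by auto
  have "invertible (rat_mat A)" "invertible (rat_mat B)"
    using assms B by (simp_all add: invertible_rat_mat invertible_mat)
  with B obtain c where "rat_mat B = mat c ** rat_mat A"
    by (auto simp: pgl_class_eq_iff)
  from derivatives_of_proportional_matrices[OF this B(1) assms]
  show "D = pgl_lie_class (mat_at_1 (mat_pderiv A))"
    using B by (simp add: pgl_lie_class_eq_iff)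
qed (use assms in blast)

section \<open>Independence of the lift\<close>

text \<open>
  The map taking the lines of \<open>u0, u1, u2\<close> to those of \<open>w0, w1, w2\<close>, with denominators cleared so
  that it makes sense for vectors of polynomials. Writing \<open>[u, v]\<close> for the bracket, it is
  \<open>v \<mapsto> [v, u1] * [w2, w1] * [u0, u2] * w0 + [u0, v] * [w0, w2] * [u2, u1] * w1\<close>.
\<close>

definition frame_map :: "'b::comm_ring_1^2 \<Rightarrow> 'b^2 \<Rightarrow> 'b^2 \<Rightarrow> 'b^2 \<Rightarrow> 'b^2 \<Rightarrow> 'b^2 \<Rightarrow> 'b^2^2" where
  "frame_map u0 u1 u2 w0 w1 w2 =
    (let br = (\<lambda>u v. u $ 1 * v $ 2 - v $ 1 * u $ 2);
         a = br w2 w1 * br u0 u2; b = br w0 w2 * br u2 u1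
     in (\<chi> i j. if j = 1 then a * w0 $ i * u1 $ 2 - b * w1 $ i * u0 $ 2
                else b * w1 $ i * u0 $ 1 - a * w0 $ i * u1 $ 1))"

text \<open>
  The first two images are read off from the formula. The third one is the Pluecker relation
  \<open>[w2, w1] * w0 + [w0, w2] * w1 = [w0, w1] * w2\<close>.
\<close>

lemma frame_map_image:
  fixes u0 u1 u2 w0 w1 w2 :: "'b::field^2"
  defines "B \<equiv> frame_map u0 u1 u2 w0 w1 w2"
  shows "B *v u0 = (bracket u0 u1 * bracket w2 w1 * bracket u0 u2) *s w0"
    and "B *v u1 = (bracket u0 u1 * bracket w0 w2 * bracket u2 u1) *s w1"
    and "B *v u2 = (bracket u2 u1 * bracket u0 u2 * bracket w0 w1) *s w2"
  unfolding B_def frame_map_def Let_def bracket_def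
  by (simp_all add: mat2_simps; algebra)+

lemma frame_map_scaled:
  fixes u0 u1 u2 :: "'b::field^2"
  shows "frame_map u0 u1 u2 (a *s u0) (b *s u1) (c *s u2) =
    mat (a * b * c * bracket u2 u1 * bracket u0 u2 * bracket u0 u1)"
  unfolding frame_map_def Let_def bracket_def
  by (simp add: mat2_simps) algebra

lemma rat_mat_frame_map:
  "rat_mat (frame_map u0 u1 u2 w0 w1 w2) =
    frame_map (rat_vec u0) (rat_vec u1) (rat_vec u2) (rat_vec w0) (rat_vec w1) (rat_vec w2)"
  by (simp add: rat_mat_def rat_vec_def frame_map_def Let_def mat2_simps rat_of_poly_simps)

lemma mat_at_1_frame_map:
  "mat_at_1 (frame_map u0 u1 u2 w0 w1 w2) =
    frame_map (vec_at_1 u0) (vec_at_1 u1) (vec_at_1 u2) (vec_at_1 w0) (vec_at_1 w1) (vec_at_1 w2)"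
  by (simp add: mat_at_1_def vec_at_1_def frame_map_def Let_def mat2_simps)

lemma pgl_value_id_representative:
  assumes "pgl_has_value_at_1 M pgl_id"
  obtains A where "mat_at_1 A = mat 1" "M = pgl_class (rat_mat A)"
proof -
  obtain A where A: "invertible (mat_at_1 A)" "M = pgl_class (rat_mat A)"
    "pgl_class (mat_at_1 A) = pgl_class (mat 1)"
    using assms by (auto simp: pgl_has_value_at_1_def pgl_id_def)
  then obtain c where c: "c \<noteq> 0" "mat_at_1 A = mat c"
    by (auto simp: pgl_class_eq_iff invertible_mat)
  define B where "B = mat [:1 / c:] ** A"
  have B1: "mat_at_1 B = mat 1"
    using c by (simp add: B_def mat_at_1_mult mat_at_1_mat mat_mult_mat)
  have "rat_of_poly [:1 / c:] \<noteq> 0" using c by (simp add: rat_of_poly_eq_0_iff)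
  then have "pgl_class (rat_mat B) = M"
    using A B1 invertible_rat_mat[of A] invertible_rat_mat[of B]
    by (auto simp: pgl_class_eq_iff invertible_mat B_def rat_mat_mult rat_mat_mat)
  with B1 that show ?thesis by blast
qed

text \<open>
  By rigidity two lifts differ by a projective map \<open>B\<close> over the rational functions, which
  conjugates the monodromies, \<open>A ** B\<close> being proportional to \<open>B ** C\<close>. Both lifts specialise to
  the same polygon, so \<open>B\<close> is scalar at \<open>1\<close>; then the derivatives of the two products
  differ only in \<open>A'\<close> and \<open>C'\<close>, as the term \<open>B'\<close> is common to both.
\<close>

lemma derivative_independent_of_lift:
  fixes P :: "int \<Rightarrow> 'a::field proj_line"
  assumes "closed_ngon n P"
    and L: "is_lift n \<eta> \<mu> P pgl_id Pt Mt" "is_lift n \<eta> \<mu> P pgl_id Qt Nt"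
  shows "pgl_derivative_at_1 Mt = pgl_derivative_at_1 Nt"
proof -
  have tw: "twisted_ngon n Pt Mt" "twisted_ngon n Qt Nt"
    and coord: "\<And>i. cross_ratio_coord Qt i = cross_ratio_coord Pt i"
    using L by (auto simp: is_lift_def)
  obtain A where A: "mat_at_1 A = mat 1" "Mt = pgl_class (rat_mat A)"
    using L by (auto simp: is_lift_def elim: pgl_value_id_representative)
  obtain C where C: "mat_at_1 C = mat 1" "Nt = pgl_class (rat_mat C)"
    using L by (auto simp: is_lift_def elim: pgl_value_id_representative)
  have "\<forall>i. \<exists>v. vec_at_1 v \<noteq> 0 \<and> Pt i = point (rat_vec v) \<and> P i = point (vec_at_1 v)"
    "\<forall>i. \<exists>v. vec_at_1 v \<noteq> 0 \<and> Qt i = point (rat_vec v) \<and> P i = point (vec_at_1 v)"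
    using L by (simp_all add: is_lift_def point_has_value_at_1_def)
  then obtain w u where
    w: "\<And>i. vec_at_1 (w i) \<noteq> 0" "\<And>i. Pt i = point (rat_vec (w i))" "\<And>i. P i = point (vec_at_1 (w i))"
    and u: "\<And>i. vec_at_1 (u i) \<noteq> 0" "\<And>i. Qt i = point (rat_vec (u i))" "\<And>i. P i = point (vec_at_1 (u i))"
    by metis
  have "\<exists>l. vec_at_1 (w i) = l *s vec_at_1 (u i)" for i
    using w u by (metis point_eq_iff_bracket bracket_eq_0_iff)
  then obtain l where l: "\<And>i. vec_at_1 (w i) = l i *s vec_at_1 (u i)" by metis
  have l0: "l i \<noteq> 0" for i
    using w(1)[of i] l[of i] by auto
  have neq: "X 0 \<noteq> X 1 \<and> X 1 \<noteq> X 2 \<and> X 0 \<noteq> X 2"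
    if "twisted_ngon n X Z" for X :: "int \<Rightarrow> 'b::field proj_line" and Z
    using that[unfolded twisted_ngon_def, THEN conjunct2, rule_format, of 0] by simp
  define B where "B = frame_map (u 0) (u 1) (u 2) (w 0) (w 1) (w 2)"
  define k where "k = l 0 * l 1 * l 2 * bracket (vec_at_1 (u 2)) (vec_at_1 (u 1))
    * bracket (vec_at_1 (u 0)) (vec_at_1 (u 2)) * bracket (vec_at_1 (u 0)) (vec_at_1 (u 1))"
  have B1: "mat_at_1 B = mat k"
    unfolding B_def k_def mat_at_1_frame_map l by (rule frame_map_scaled)
  have "P 0 \<noteq> P 1" "P 2 \<noteq> P 1" "P 0 \<noteq> P 2"
    using neq[OF assms(1)[unfolded closed_ngon_def]] by auto
  then have k: "k \<noteq> 0"
    by (simp add: k_def l0 point_eq_iff_bracket u(1) u(3))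
  have inv: "invertible (rat_mat A)" "invertible (rat_mat B)" "invertible (rat_mat C)"
    using A C B1 k by (simp_all add: invertible_rat_mat invertible_mat)
  have nz: "rat_vec (u i) \<noteq> 0" "rat_vec (w i) \<noteq> 0" for i
    using u w by (simp_all add: rat_vec_nonzero)
  have "Qt 0 \<noteq> Qt 1" "Qt 2 \<noteq> Qt 1" "Qt 0 \<noteq> Qt 2" "Pt 0 \<noteq> Pt 1" "Pt 2 \<noteq> Pt 1" "Pt 0 \<noteq> Pt 2"
    using neq[OF tw(1)] neq[OF tw(2)] by auto
  then have brackets: "bracket (rat_vec (u 0)) (rat_vec (u 1)) \<noteq> 0"
    "bracket (rat_vec (u 2)) (rat_vec (u 1)) \<noteq> 0" "bracket (rat_vec (u 0)) (rat_vec (u 2)) \<noteq> 0"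
    "bracket (rat_vec (w 0)) (rat_vec (w 1)) \<noteq> 0" "bracket (rat_vec (w 2)) (rat_vec (w 1)) \<noteq> 0"
    "bracket (rat_vec (w 0)) (rat_vec (w 2)) \<noteq> 0"
    by (simp_all add: u(2) w(2) point_eq_iff_bracket nz)
  have "point (rat_mat B *v rat_vec (u i)) = point (rat_vec (w i))" if "i \<in> {0, 1, 2}" for i
    using that brackets nz unfolding B_def rat_mat_frame_map
    by (auto simp: frame_map_image intro!: point_scale)
  then have frame: "pgl_apply (pgl_class (rat_mat B)) (Qt i) = Pt i" if "i \<in> {0, 1, 2}" for i
    using that by (simp only: u(2) w(2) pgl_apply_class inv nz not_False_eq_True)
  have match: "pgl_apply (pgl_class (rat_mat B)) (Qt (int j)) = Pt (int j)" for j
    using tw coord inv(2) frame by (rule ngon_determined_by_cross_ratios)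
  have "pgl_class (rat_mat A ** rat_mat B) = pgl_class (rat_mat B ** rat_mat C)"
  proof (rule pgl_eq_if_agree_on_frame)
    show "Qt 0 \<noteq> Qt 1" "Qt 1 \<noteq> Qt 2" "Qt 0 \<noteq> Qt 2"
      using neq[OF tw(2)] by auto
    fix x assume "x \<in> {Qt 0, Qt 1, Qt 2}"
    then obtain j :: nat where x: "x = Qt (int j)"
      by (metis insertE singletonD of_nat_0 of_nat_1 of_nat_numeral)
    have "pgl_apply (pgl_class (rat_mat A ** rat_mat B)) x = Pt (int j + int n)"
      using tw(1) by (simp add: pgl_apply_mult inv x match A twisted_ngon_def)
    also have "\<dots> = pgl_apply (pgl_class (rat_mat B)) (Qt (int j + int n))"
      using match[of "j + n"] by simp
    also have "\<dots> = pgl_apply (pgl_class (rat_mat B ** rat_mat C)) x"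
      using tw(2) by (simp add: pgl_apply_mult inv x C twisted_ngon_def)
    finally show "pgl_apply (pgl_class (rat_mat A ** rat_mat B)) x
      = pgl_apply (pgl_class (rat_mat B ** rat_mat C)) x" .
  qed (use inv in \<open>simp_all add: invertible_mult\<close>)
  then obtain c where "rat_mat (A ** B) = mat c ** rat_mat (B ** C)"
    using inv by (auto simp: pgl_class_eq_iff invertible_mult rat_mat_mult)
  then obtain d where "mat_at_1 (mat_pderiv (A ** B)) - mat_at_1 (mat_pderiv (B ** C)) = mat d"
    using derivatives_of_proportional_matrices[of "A ** B" c "B ** C" k] k
    by (auto simp: mat_at_1_mult A C B1)
  then have "mat k ** (mat_at_1 (mat_pderiv A) - mat_at_1 (mat_pderiv C)) = mat d"
    by (simp add: mat_at_1_pderiv_mult A C B1 mat_commutes mat2_simps algebra_simps)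
  then have "mat (1 / k) ** (mat k ** (mat_at_1 (mat_pderiv A) - mat_at_1 (mat_pderiv C))) = mat (d / k)"
    by (simp add: mat_mult_mat)
  then have "mat_at_1 (mat_pderiv A) - mat_at_1 (mat_pderiv C) = mat (d / k)"
    using k by (simp add: matrix_mul_assoc mat_mult_mat)
  then show ?thesis
    using A C by (auto simp: pgl_derivative_at_1_class pgl_lie_class_eq_iff)
qed

section \<open>Shears and their products\<close>

text \<open>The projection onto the line of \<open>(a, 1)\<close> along that of \<open>(b, 1)\<close>, times \<open>m\<close>.\<close>

definition shear_velocity :: "'a::field \<Rightarrow> 'a \<Rightarrow> 'a \<Rightarrow> 'a^2^2" where
  "shear_velocity m a b =
    mat (m * (1 / (a - b))) ** vector [vector [a, - (a * b)], vector [1, - b]]"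

text \<open>This is \<open>mat 1 + (t - 1) * shear_velocity m a b\<close>, entry by entry.\<close>

definition shear :: "'a::field \<Rightarrow> 'a \<Rightarrow> 'a \<Rightarrow> 'a poly^2^2" where
  "shear m a b = (\<chi> i j. [:(mat 1 - shear_velocity m a b) $ i $ j, shear_velocity m a b $ i $ j:])"

definition const_vec :: "'a::field \<Rightarrow> 'a poly^2" where
  "const_vec a = vector [[:a:], 1]"

lemma vec_at_1_const_vec: "vec_at_1 (const_vec a) = vector [a, 1]"
  by (simp add: vec_at_1_def const_vec_def mat2_simps)

lemma affine_vec_nonzero: "(vector [a, 1] :: 'a::field^2) \<noteq> 0"
  by (simp add: mat2_simps)

lemma shear_at_1: "mat_at_1 (shear m a b) = mat 1"
  by (simp add: mat_at_1_def shear_def mat2_simps)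

lemma shear_derivative: "mat_at_1 (mat_pderiv (shear m a b)) = shear_velocity m a b"
  by (simp add: mat_at_1_def mat_pderiv_def shear_def mat2_simps pderiv_pCons)

lemma shear_velocity_cleared:
  assumes "a \<noteq> b"
  shows "shear_velocity (r * (a - b)) a b = mat r ** vector [vector [a, - (a * b)], vector [1, - b]]"
    and "shear_velocity (r * (a - b)) b a = mat (- r) ** vector [vector [b, - (b * a)], vector [1, - a]]"
proof -
  have "a - b \<noteq> 0" "1 / (b - a) = - (1 / (a - b))"
    using assms minus_divide_right[of 1 "a - b"] by simp_all
  then have "r * (a - b) * (1 / (a - b)) = r" "r * (a - b) * (1 / (b - a)) = - r"
    by simp_all
  then show "shear_velocity (r * (a - b)) a b = mat r ** vector [vector [a, - (a * b)], vector [1, - b]]"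
    "shear_velocity (r * (a - b)) b a = mat (- r) ** vector [vector [b, - (b * a)], vector [1, - a]]"
    unfolding shear_velocity_def by (simp_all only:)
qed

text \<open>
  The determinant is the eigenvalue at \<open>a\<close>, and exchanging the two fixed points inverts a shear
  up to scale.
\<close>

lemma
  assumes "a \<noteq> b"
  shows shear_eigenvectors:
      "shear m a b *v const_vec a = [:1 - m, m:] *s const_vec a"
      "shear m a b *v const_vec b = const_vec b"
    and det_shear: "det (shear m a b) = [:1 - m, m:]"
    and shear_swap: "shear m b a ** shear m a b = mat [:1 - m, m:]"
proof -
  \<comment> \<open>In terms of \<open>r\<close> all entries are polynomial in \<open>a, b, r\<close>.\<close>
  obtain r where r: "m = r * (a - b)"
    using assms that[of "m / (a - b)"] by simp
  show "shear m a b *v const_vec a = [:1 - m, m:] *s const_vec a"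
    "shear m a b *v const_vec b = const_vec b"
    "det (shear m a b) = [:1 - m, m:]"
    "shear m b a ** shear m a b = mat [:1 - m, m:]"
    unfolding r shear_def shear_velocity_cleared[OF assms]
    by (simp_all add: const_vec_def det_2 mat2_simps algebra_simps)
qed

text \<open>
  In a coordinate with \<open>a\<close> at infinity and \<open>b\<close> at \<open>0\<close>, the cross-ratio is the quotient of its last two
  arguments, and the shear multiplies the coordinate by its eigenvalue.
\<close>

lemma cross_ratio_shear:
  fixes a b m :: "'a::field"
  defines "A \<equiv> point (rat_vec (const_vec a))" and "B \<equiv> point (rat_vec (const_vec b))"
  assumes "a \<noteq> b" "C \<noteq> A" "C \<noteq> B" "D \<noteq> A"
  shows "cross_ratio A B C (pgl_apply (pgl_class (rat_mat (shear m a b))) D)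
    = rat_of_poly [:1 - m, m:] * cross_ratio A B C D"
proof -
  define s where "s = rat_of_poly [:1 - m, m:]"
  have s: "s \<noteq> 0" unfolding s_def by (rule rat_of_poly_nonzero_if_value) simp
  let ?S = "rat_mat (shear m a b)" and ?a = "rat_vec (const_vec a)" and ?b = "rat_vec (const_vec b)"
  have inv: "invertible ?S" by (simp add: invertible_rat_mat shear_at_1 invertible_mat)
  have nz: "?a \<noteq> 0" "?b \<noteq> 0"
    by (simp_all add: rat_vec_nonzero vec_at_1_const_vec affine_vec_nonzero)
  obtain c where c: "c \<noteq> 0" "C = point c" by (rule point_cases)
  obtain d where d: "d \<noteq> 0" "D = point d" by (rule point_cases)
  have S: "?S *v ?a = s *s ?a" "?S *v ?b = ?b" "det ?S = s"
    using \<open>a \<noteq> b\<close>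
    by (simp_all add: s_def det_rat_mat det_shear shear_eigenvectors rat_vec_scale flip: rat_vec_mult)
  have "s * bracket ?a (?S *v d) = s * bracket ?a d"
    using bracket_mat[of ?S ?a d] bracket_scale[of s ?a 1 "?S *v d"] by (auto simp: S)
  moreover have "bracket ?b (?S *v d) = s * bracket ?b d"
    using bracket_mat[of ?S ?b d] by (simp add: S)
  ultimately show ?thesis
    using s nz c d inv
    by (simp add: A_def B_def pgl_apply_class cross_ratio_point invertible_vec_nonzero
        flip: s_def)
qed

primrec running_product :: "(nat \<Rightarrow> 'b::semiring_1^2^2) \<Rightarrow> nat \<Rightarrow> 'b^2^2" where
  "running_product H 0 = mat 1"
| "running_product H (Suc k) = running_product H k ** H k"

text \<open>
  The product of the shears at the edges \<open>1, \<dots>, j\<close>. For negative \<open>j\<close> it is the inverse of the product of the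
  shears at \<open>j + 1, \<dots>, 0\<close> up to a scalar factor, the inverses being taken by exchanging fixed points
  so that the entries stay polynomial.
\<close>

definition development :: "(int \<Rightarrow> 'a::field) \<Rightarrow> (int \<Rightarrow> 'a) \<Rightarrow> int \<Rightarrow> 'a poly^2^2" where
  "development m p j =
    (if 0 \<le> j
     then running_product (\<lambda>k. shear (m (int k + 1)) (p (int k + 1)) (p (int k + 2))) (nat j)
     else running_product (\<lambda>k. shear (m (- int k)) (p (1 - int k)) (p (- int k))) (nat (- j)))"

lemma development_0: "development m p 0 = mat 1"
  by (simp add: development_def)

lemma development_at_1: "mat_at_1 (development m p j) = mat 1"
proof -
  have "mat_at_1 (running_product H k) = mat 1" if "\<And>k. mat_at_1 (H k) = mat 1"
    for H :: "nat \<Rightarrow> 'a poly^2^2" and k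
    by (induction k) (simp_all add: mat_at_1_mat mat_at_1_mult that)
  then show ?thesis by (simp add: development_def shear_at_1)
qed

lemma development_derivative:
  "mat_at_1 (mat_pderiv (development m p (int n))) =
    (\<Sum>i = 1..int n. shear_velocity (m i) (p i) (p (i + 1)))"
proof (induction n)
  case 0
  then show ?case
    by (simp add: development_0 mat_at_1_def mat_pderiv_def mat2_simps)
next
  case (Suc n)
  have "development m p (int (Suc n)) =
      development m p (int n) ** shear (m (int n + 1)) (p (int n + 1)) (p (int n + 2))"
    by (simp add: development_def nat_add_distrib)
  moreover have "{1..int (Suc n)} = insert (int n + 1) {1..int n}" by auto
  ultimately show ?case
    by (simp add: mat_at_1_pderiv_mult shear_at_1 shear_derivative development_at_1 Suc add.commute)
qed

lemma development_step:
  assumes "p j \<noteq> p (j + 1)"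
  shows "\<exists>c. poly c 1 = 1 \<and>
    development m p (j - 1) ** shear (m j) (p j) (p (j + 1)) = mat c ** development m p j"
proof (cases "0 < j")
  case True
  then have "nat j = Suc (nat (j - 1))" by simp
  with True show ?thesis by (intro exI[of _ 1]) (simp add: development_def add.commute)
next
  case False
  then have "nat (- (j - 1)) = Suc (nat (- j))" by simp
  with False have "development m p (j - 1) = development m p j ** shear (m j) (p (j + 1)) (p j)"
    by (simp add: development_def add.commute)
  then show ?thesis
    using assms
    by (intro exI[of _ "[:1 - m j, m j:]"])
      (simp add: shear_swap mat_commutes flip: matrix_mul_assoc)
qed

lemma rat_const_divide: "rat_const (a / b) = rat_const a / rat_const b"
proof (cases "b = 0")
  case False
  then have "rat_const b \<noteq> 0" by (simp add: rat_const_def rat_of_poly_eq_0_iff)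
  moreover have "rat_const (a / b) * rat_const b = rat_const a"
    using False by (simp add: rat_const_def flip: rat_of_poly_simps)
  ultimately show ?thesis by (simp add: field_simps)
qed (simp add: rat_const_def rat_of_poly_simps)

lemma cross_ratio_const:
  "cross_ratio (point (rat_vec (const_vec a))) (point (rat_vec (const_vec b)))
      (point (rat_vec (const_vec c))) (point (rat_vec (const_vec d)))
    = rat_const (cross_ratio (affine_point a) (affine_point b) (affine_point c) (affine_point d))"
proof -
  have "bracket (rat_vec (const_vec x)) (rat_vec (const_vec y)) = rat_const (x - y)" for x y :: 'a
    by (simp add: bracket_rat_vec const_vec_def rat_const_def mat2_simps)
  moreover have "rat_const (x * y) = rat_const x * rat_const y" for x y :: 'a
    by (simp add: rat_const_def mult.commute flip: rat_of_poly_simps)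
  ultimately show ?thesis
    by (simp add: cross_ratio_affine cross_ratio_point rat_const_divide rat_vec_nonzero
        vec_at_1_const_vec affine_vec_nonzero)
qed

text \<open>
  The scaled coordinate is the coordinate times the denominator of the scaled curvature, which is
  the eigenvalue of the shear with \<open>m\<close> replaced by \<open>\<eta> * m\<close>.
\<close>

lemma scaled_coord_rat:
  assumes "m \<noteq> 0"
  shows "scaled_coord (rat_const \<eta>) rat_t (rat_const m) c = rat_of_poly [:1 - \<eta> * m, \<eta> * m:] * c"
proof -
  have "[:1 - \<eta> * m, \<eta> * m:] = 1 + ([:0, 1:] - 1) * [:\<eta>:] * [:m:]"
    by (simp add: one_pCons algebra_simps)
  then have "rat_of_poly [:1 - \<eta> * m, \<eta> * m:] = 1 + (rat_t - 1) * rat_const \<eta> * rat_const m"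
    by (simp only: rat_t_def rat_const_def rat_of_poly_simps)
  moreover have "rat_t * rat_const m \<noteq> (0 :: 'a poly fract)"
    using assms by (simp add: rat_t_def rat_const_def rat_of_poly_eq_0_iff)
  ultimately show ?thesis
    by (simp add: scaled_coord_def scaled_curvature_def)
qed

section \<open>Construction of a lift\<close>

lemma affine_point_eq_iff: "affine_point a = affine_point b \<longleftrightarrow> a = b"
  by (auto simp: affine_point_def point_eq_iff_bracket affine_vec_nonzero bracket_def mat2_simps)

lemma pgl_apply_id: "pgl_apply pgl_id x = x"
proof -
  obtain v where "v \<noteq> 0" "x = point v" by (rule point_cases)
  then show ?thesis by (simp add: pgl_id_def pgl_apply_class invertible_mat)
qed

lemma closed_affine_ngon:
  assumes "closed_ngon n (\<lambda>i. affine_point (p i))"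
  shows "p (i + int n) = p i" "p i \<noteq> p (i + 1)" "p i \<noteq> p (i + 2)"
  using assms by (auto simp: closed_ngon_def twisted_ngon_def pgl_apply_id affine_point_eq_iff)

text \<open>
  The vertices \<open>p j\<close> are moved by the product of the shears at the edges \<open>1, \<dots>, j\<close>. Since the shears
  at the two edges of a vertex fix that vertex, relative to the frame preceding edge \<open>i\<close> only the
  last of the vertices \<open>i - 1, i, i + 1, i + 2\<close> moves, by the shear at edge \<open>i\<close>: the coordinate
  \<open>i\<close> is multiplied by the eigenvalue of that shear.
\<close>

lemma development_is_lift:
  fixes p \<mu> :: "int \<Rightarrow> 'a::field" and \<eta> :: 'a
  assumes closed: "closed_ngon n (\<lambda>i. affine_point (p i))"
    and curv: "discrete_curvature n \<mu>"
  defines "m \<equiv> \<lambda>i. \<eta> * \<mu> i"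
  shows "is_lift n \<eta> \<mu> (\<lambda>i. affine_point (p i)) pgl_id
    (\<lambda>j. point (rat_vec (development m p j *v const_vec (p j))))
    (pgl_class (rat_mat (development m p (int n))))"
proof -
  define g where "g j = pgl_apply (pgl_class (rat_mat (development m p j)))" for j
  define h where "h j = pgl_apply (pgl_class (rat_mat (shear (m j) (p j) (p (j + 1)))))" for j
  define v where "v j = point (rat_vec (const_vec (p j)))" for j
  note p = closed_affine_ngon[OF closed]
  have \<mu>: "\<mu> i \<noteq> 0" "\<mu> (i + int n) = \<mu> i" for i
    using curv by (auto simp: discrete_curvature_def)
  have nzv: "rat_vec (const_vec a) \<noteq> 0" for a :: 'a
    by (simp add: rat_vec_nonzero vec_at_1_const_vec affine_vec_nonzero)
  have invg: "invertible (rat_mat (development m p j))" for j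
    by (simp add: invertible_rat_mat development_at_1 invertible_mat)
  have invh: "invertible (rat_mat (shear (m j) (p j) (p (j + 1))))" for j
    by (simp add: invertible_rat_mat shear_at_1 invertible_mat)
  have vertex: "point (rat_vec (development m p j *v const_vec (p j))) = g j (v j)" for j
    by (simp add: g_def v_def rat_vec_mult pgl_apply_class invg nzv)

  have h_fixes: "h j (v j) = v j" "h j (v (j + 1)) = v (j + 1)" for j
  proof -
    have "rat_of_poly [:1 - m j, m j:] \<noteq> 0"
      by (rule rat_of_poly_nonzero_if_value) simp
    then show "h j (v j) = v j" "h j (v (j + 1)) = v (j + 1)"
      using p(2)[of j] invh[of j]
      by (simp_all add: h_def v_def pgl_apply_class nzv shear_eigenvectors rat_vec_scale point_scale
          flip: rat_vec_mult)
  qed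
  have step: "g (j - 1) (h j x) = g j x" for j x
  proof -
    obtain c where c: "poly c 1 = 1"
      "development m p (j - 1) ** shear (m j) (p j) (p (j + 1)) = mat c ** development m p j"
      using development_step[of p j m] p(2)[of j] by blast
    then have "rat_mat (development m p (j - 1)) ** rat_mat (shear (m j) (p j) (p (j + 1)))
        = mat (rat_of_poly c) ** rat_mat (development m p j)"
      by (simp flip: rat_mat_mult rat_mat_mat)
    moreover have "rat_of_poly c \<noteq> 0"
      using c by (intro rat_of_poly_nonzero_if_value) simp
    ultimately have "pgl_class (rat_mat (development m p (j - 1)) **
        rat_mat (shear (m j) (p j) (p (j + 1)))) = pgl_class (rat_mat (development m p j))"
      using invg invh by (auto simp: pgl_class_eq_iff invertible_mult invertible_mat)
    then show ?thesis
      using invg invh by (simp add: g_def h_def flip: pgl_apply_mult)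
  qed
  have step': "g (j + 1) x = g j (h (j + 1) x)" for j x
    using step[of "j + 1" x] by simp

  \<comment> \<open>Surjectivity serves to run the induction for \<open>g_period\<close> towards negative indices.\<close>
  have h_surj: "\<exists>y. x = h j y" for j x
  proof -
    obtain u where u: "u \<noteq> 0" "x = point u" by (rule point_cases)
    obtain S where S: "rat_mat (shear (m j) (p j) (p (j + 1))) ** S = mat 1"
      "S ** rat_mat (shear (m j) (p j) (p (j + 1))) = mat 1"
      using invh by (metis invertible_def)
    then have "invertible S" by (metis invertible_def)
    then have "S *v u \<noteq> 0" using u invertible_vec_nonzero by blast
    then have "h j (point (S *v u)) = x"
      using u S by (simp add: h_def pgl_apply_class invh matrix_vector_mul_assoc)
    then show ?thesis by blast
  qed
  have h_period: "h (j + int n) = h j" for j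
    using p(1)[of "j + 1"] by (simp add: h_def m_def p(1) \<mu> algebra_simps)
  have g_period: "g (j + int n) x = g (int n) (g j x)" for j x
  proof (induction j arbitrary: x rule: int_induct[where k = 0])
    case base
    have "g 0 x = x" using pgl_apply_id[of x] by (simp add: g_def development_0 rat_mat_mat
        rat_of_poly_simps pgl_id_def)
    then show ?case by simp
  next
    case (step1 i)
    have "g (i + 1 + int n) x = g (i + int n) (h (i + 1) x)"
      using step'[of "i + int n" x] h_period[of "i + 1"] by (simp add: algebra_simps)
    then show ?case by (simp add: step1 step')
  next
    case (step2 i)
    obtain y where y: "x = h i y" using h_surj by blast
    have "g (i - 1 + int n) (h i y) = g (i + int n) y"
      using step[of "i + int n" y] h_period[of i] by (simp add: algebra_simps)
    then show ?case by (simp add: y step step2)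
  qed
  have v_period: "v (j + int n) = v j" for j
    by (simp add: v_def p(1))

  have vertex_value: "point_has_value_at_1 (g j (v j)) (affine_point (p j))" for j
    unfolding point_has_value_at_1_def
    by (intro exI[of _ "development m p j *v const_vec (p j)"])
      (simp add: vertex vec_at_1_mult development_at_1 vec_at_1_const_vec affine_vec_nonzero
        affine_point_def)
  have twisted: "twisted_ngon n (\<lambda>j. g j (v j)) (pgl_class (rat_mat (development m p (int n))))"
    unfolding twisted_ngon_def
  proof (intro conjI allI)
    have distinct: "g i (v i) \<noteq> g j (v j)" if "p i \<noteq> p j" for i j
      using that points_distinct_if_values_distinct[OF vertex_value vertex_value]
      by (simp add: affine_point_eq_iff)
    fix i
    show "g i (v i) \<noteq> g (i + 1) (v (i + 1))" "g i (v i) \<noteq> g (i + 2) (v (i + 2))"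
      by (intro distinct p)+
    show "g (i + 1) (v (i + 1)) \<noteq> g (i + 2) (v (i + 2))"
      using p(2)[of "i + 1"] by (intro distinct) (simp add: add.assoc)
    show "g (i + int n) (v (i + int n)) =
        pgl_apply (pgl_class (rat_mat (development m p (int n)))) (g i (v i))"
      by (simp add: g_period v_period flip: g_def)
  qed

  have coord: "cross_ratio_coord (\<lambda>j. g j (v j)) i =
      rat_of_poly [:1 - m i, m i:] * rat_const (cross_ratio_coord (\<lambda>i. affine_point (p i)) i)" for i
  proof -
    \<comment> \<open>All four vertices in the frame preceding edge \<open>i\<close>.\<close>
    have v1: "g i (v i) = g (i - 1) (v i)"
      using step[of i "v i"] by (simp add: h_fixes)
    have v2: "g (i + 1) (v (i + 1)) = g (i - 1) (v (i + 1))"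
      using step[of i "v (i + 1)"] by (simp add: h_fixes step')
    have "g (i + 1 + 1) (v (i + 1 + 1)) = g (i - 1) (h i (v (i + 1 + 1)))"
      using h_fixes(2)[of "i + 1"] by (simp only: step' step h_fixes)
    then have v3: "g (i + 2) (v (i + 2)) = g (i - 1) (h i (v (i + 2)))"
      by (simp add: add.assoc)
    have v_inj: "v a = v b \<longleftrightarrow> p a = p b" for a b
      unfolding v_def point_eq_iff_bracket[OF nzv nzv] bracket_rat_vec rat_of_poly_eq_0_iff
      by (simp add: const_vec_def mat2_simps)
    have "cross_ratio_coord (\<lambda>j. g j (v j)) i =
        cross_ratio (v i) (v (i + 1)) (v (i - 1)) (h i (v (i + 2)))"
      unfolding cross_ratio_coord_def v1 v2 v3
      unfolding g_def by (rule cross_ratio_pgl_apply[OF invg])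
    also have "\<dots> = rat_of_poly [:1 - m i, m i:] * cross_ratio (v i) (v (i + 1)) (v (i - 1)) (v (i + 2))"
      unfolding h_def v_def
    proof (rule cross_ratio_shear)
      show "p i \<noteq> p (i + 1)" by (rule p)
    qed (use p(2)[of "i - 1"] p(3)[of "i - 1"] p(3)[of i] in \<open>auto simp flip: v_def simp: v_inj add.commute\<close>)
    also have "\<dots> = rat_of_poly [:1 - m i, m i:] * rat_const (cross_ratio_coord (\<lambda>i. affine_point (p i)) i)"
      by (simp add: v_def cross_ratio_const cross_ratio_coord_def)
    finally show ?thesis .
  qed

  have "pgl_has_value_at_1 (pgl_class (rat_mat (development m p (int n)))) pgl_id"
    unfolding pgl_has_value_at_1_def pgl_id_def
    by (intro exI[of _ "development m p (int n)"]) (simp add: development_at_1 invertible_mat)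
  with twisted vertex_value coord show ?thesis
    unfolding is_lift_def vertex by (simp add: scaled_coord_rat \<mu> m_def)
qed

section \<open>The infinitesimal monodromy\<close>

lemma eigenvector_iff_bracket:
  "pgl_lie_eigenvector (pgl_lie_class A) v \<longleftrightarrow> v \<noteq> 0 \<and> bracket (A *v v) v = 0"
  unfolding pgl_lie_class_def by (auto simp: pgl_lie_eigenvector.abs_eq bracket_eq_0_iff)

lemma bracket_sum_mat:
  assumes "finite I"
  shows "bracket ((\<Sum>i\<in>I. A i) *v v) v = (\<Sum>i\<in>I. bracket (A i *v v) v)"
  using assms
  by (induction I) (simp_all add: bracket_def mat2_simps algebra_simps)

lemma bracket_shear_velocity:
  "bracket (shear_velocity m a b *v vector [X, Y]) (vector [X, Y])
    = - (m * ((X - a * Y) * (X - b * Y) / (a - b)))"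
proof -
  define r where "r = 1 / (a - b)"
  have "bracket (shear_velocity m a b *v vector [X, Y]) (vector [X, Y])
    = - (m * ((X - a * Y) * (X - b * Y) * r))"
    unfolding shear_velocity_def r_def[symmetric]
    by (simp add: bracket_def mat2_simps algebra_simps)
  then show ?thesis by (simp add: r_def)
qed

theorem proposition6p7:
  fixes n :: nat and p \<mu> :: "int \<Rightarrow> 'a::field" and \<eta> :: 'a
  assumes "n \<ge> 3"
    and "closed_ngon n (\<lambda>i. affine_point (p i))"
    and "discrete_curvature n \<mu>"
    and "\<eta> \<noteq> 0"
  shows "(\<exists>Pt Mt. is_lift n \<eta> \<mu> (\<lambda>i. affine_point (p i)) pgl_id Pt Mt) \<and>
    (\<forall>Pt Mt. is_lift n \<eta> \<mu> (\<lambda>i. affine_point (p i)) pgl_id Pt Mt \<longrightarrow>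
       pgl_derivative_at_1 Mt = pgl_lie_class
         (\<Sum>i = 1..int n. mat (\<eta> * \<mu> i * (1 / (p i - p (i + 1)))) **
            vector [vector [p i, - (p i * p (i + 1))],
                    vector [1,   - p (i + 1)]]) \<and>
       (\<forall>X Y. (X, Y) \<noteq> (0, 0) \<longrightarrow>
          (pgl_lie_eigenvector (pgl_derivative_at_1 Mt) (vector [X, Y]) \<longleftrightarrow>
           (\<Sum>i = 1..int n. \<mu> i * ((X - p i * Y) * (X - p (i + 1) * Y) / (p i - p (i + 1)))) = 0)))"
proof -
  define m where "m = (\<lambda>i. \<eta> * \<mu> i)"
  define V where "V = (\<Sum>i = 1..int n. shear_velocity (m i) (p i) (p (i + 1)))"
  define Q where "Q = (\<lambda>j. point (rat_vec (development m p j *v const_vec (p j))))"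
  define N where "N = pgl_class (rat_mat (development m p (int n)))"
  have lift: "is_lift n \<eta> \<mu> (\<lambda>i. affine_point (p i)) pgl_id Q N"
    unfolding Q_def N_def m_def using assms(2,3) by (rule development_is_lift)
  have "pgl_derivative_at_1 N = pgl_lie_class V"
    by (simp add: N_def V_def pgl_derivative_at_1_class development_at_1 development_derivative)
  then have deriv: "pgl_derivative_at_1 Mt = pgl_lie_class V"
    if "is_lift n \<eta> \<mu> (\<lambda>i. affine_point (p i)) pgl_id Pt Mt" for Pt Mt
    using derivative_independent_of_lift[OF assms(2) that lift] by simp
  have "pgl_lie_eigenvector (pgl_lie_class V) (vector [X, Y]) \<longleftrightarrow>
      (\<Sum>i = 1..int n. \<mu> i * ((X - p i * Y) * (X - p (i + 1) * Y) / (p i - p (i + 1)))) = 0"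
    if "(X, Y) \<noteq> (0, 0)" for X Y
  proof -
    have "bracket (V *v vector [X, Y]) (vector [X, Y]) =
      - \<eta> * (\<Sum>i = 1..int n. \<mu> i * ((X - p i * Y) * (X - p (i + 1) * Y) / (p i - p (i + 1))))"
      by (simp add: V_def bracket_sum_mat bracket_shear_velocity m_def sum_distrib_left mult.assoc
          flip: sum_negf)
    moreover have "(vector [X, Y] :: 'a^2) \<noteq> 0" using that by (auto simp: mat2_simps)
    ultimately show ?thesis using \<open>\<eta> \<noteq> 0\<close> by (simp add: eigenvector_iff_bracket)
  qed
  with lift deriv show ?thesis
    unfolding V_def shear_velocity_def m_def by auto
qed

end
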